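(* Let $X$ be a countably infinite set. Then the maximal inverse subsemigroups of $I_X$ which contain $\operatorname{Sym}(X)$ are exactly the following two: $$\mathcal{S} = \{ f \in I_X \mid c(f) > 0 \text{ and } d(f) > 0 \} \cup \operatorname{Sym}(X),$$ $$\mathcal{T} = \{ f \in I_X \mid c(f) = d(f) = \aleph_0, \text{ or } (c(f) < \aleph_0 \text{ and } d(f) < \aleph_0) \}.$$
   Context: For a set $X$, $I_X$ is the symmetric inverse monoid: the set of all bijections between subsets of $X$ (partial bijections, called charts) under composition of partial functions, written left to right. $\operatorname{Sym}(X) \subseteq I_X$ is the group of all permutations of $X$. For $f \in I_X$, the defect is $d(f) = |X \setminus \operatorname{im}(f)|$ and the collapse is $c(f) = |X \setminus \operatorname{dom}(f)|$. An inverse subsemigroup of $I_X$ is a subsemigroup closed under $f\mapsto f^{-1}$; a maximal inverse subsemigroup of $I_X$ is a proper inverse subsemigroup that is maximal under containment among the proper inverse subsemigroups of $I_X$. *)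

theory Defs
  imports "HOL-Library.Countable_Set"
begin

unbundle cardinal_syntax

text \<open>
  Charts are represented by their graphs.  With this encoding, composition of partial functions
  written left to right is relational composition \<open>f O g\<close> (first \<open>f\<close>, then \<open>g\<close>),
  and the inverse of a chart is its converse \<open>f\<inverse>\<close>.
\<close>

definition sym_inv_monoid :: "'a set \<Rightarrow> 'a rel set" where
  "sym_inv_monoid X = {f. f \<subseteq> X \<times> X \<and> single_valued f \<and> single_valued (f\<inverse>)}"

definition Sym :: "'a set \<Rightarrow> 'a rel set" where
  "Sym X = {f \<in> sym_inv_monoid X. Domain f = X \<and> Range f = X}"

text \<open>
  Defect and collapse are cardinals of the HOL cardinal library (cardinal orders on the underlying
  type); they are compared with \<open>=o\<close> and \<open><o\<close>, with \<open>natLeq\<close> for aleph-zero and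
  \<open>czero\<close> for zero.
\<close>

definition defect :: "'a set \<Rightarrow> 'a rel \<Rightarrow> 'a rel" where
  "defect X f = |X - Range f|"

definition collapse :: "'a set \<Rightarrow> 'a rel \<Rightarrow> 'a rel" where
  "collapse X f = |X - Domain f|"

definition inverse_subsemigroup :: "'a set \<Rightarrow> 'a rel set \<Rightarrow> bool" where
  "inverse_subsemigroup X M \<longleftrightarrow>
     M \<subseteq> sym_inv_monoid X \<and>
     (\<forall>f\<in>M. \<forall>g\<in>M. f O g \<in> M) \<and>
     (\<forall>f\<in>M. f\<inverse> \<in> M)"

definition maximal_inverse_subsemigroup :: "'a set \<Rightarrow> 'a rel set \<Rightarrow> bool" where
  "maximal_inverse_subsemigroup X M \<longleftrightarrow>
     inverse_subsemigroup X M \<and> M \<noteq> sym_inv_monoid X \<and>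
     (\<forall>N. inverse_subsemigroup X N \<and> N \<noteq> sym_inv_monoid X \<and> M \<subseteq> N \<longrightarrow> N = M)"

definition semigroup_S :: "'a set \<Rightarrow> 'a rel set" where
  "semigroup_S X =
     {f \<in> sym_inv_monoid X. (czero :: 'a rel) <o collapse X f \<and> (czero :: 'a rel) <o defect X f}
     \<union> Sym X"

definition semigroup_T :: "'a set \<Rightarrow> 'a rel set" where
  "semigroup_T X =
     {f \<in> sym_inv_monoid X.
        (collapse X f =o natLeq \<and> defect X f =o natLeq) \<or>
        (collapse X f <o natLeq \<and> defect X f <o natLeq)}"

end

theory Submission
  imports Defs
begin

text \<open>
  Membership in \<open>\<S>\<close> means that \<open>f\<close> is total iff it is onto, and membership in \<open>\<T>\<close> that it has
  cofinite domain iff it has cofinite image.  Both classes are inverse subsemigroups and neither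
  contains the other, so everything follows once an inverse subsemigroup \<open>M\<close> containing all
  permutations and contained in neither class is shown to be all of \<open>I\<^sub>X\<close>.  Such an \<open>M\<close> contains a
  total chart \<open>f\<close> that is not onto and a chart \<open>g\<close> of finite collapse and infinite defect.
  Composing \<open>f\<close>, a transposition moving a missed point of \<open>f\<close> out of the domain of \<open>g\<close>, and \<open>g\<close>
  lowers the collapse, so \<open>M\<close> contains a total chart of infinite defect.  By countability all such
  charts differ by a permutation, hence all of them lie in \<open>M\<close>.  Finally every chart is \<open>v O w\<inverse>\<close>
  for two of them: amalgamate two copies of \<open>X\<close> along the chart.
\<close>

section \<open>The monoid of charts\<close>

lemma inv_monoidD:
  assumes "f \<in> sym_inv_monoid X"
  shows "f \<subseteq> X \<times> X" "Domain f \<subseteq> X" "Range f \<subseteq> X" "single_valued f" "single_valued (f\<inverse>)"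
  using assms by (auto simp: sym_inv_monoid_def)

lemma inv_monoid_relcomp:
  assumes "f \<in> sym_inv_monoid X" "g \<in> sym_inv_monoid X"
  shows "f O g \<in> sym_inv_monoid X"
  using assms unfolding sym_inv_monoid_def
  by (auto simp: converse_relcomp intro: single_valued_relcomp)

lemma inv_monoid_converse: "f \<in> sym_inv_monoid X \<Longrightarrow> f\<inverse> \<in> sym_inv_monoid X"
  by (auto simp: sym_inv_monoid_def)

lemma inv_monoid_Un:
  fixes f g :: "'a rel"
  assumes "f \<in> sym_inv_monoid X" "g \<in> sym_inv_monoid X"
    and "Domain f \<inter> Domain g = {}" "Range f \<inter> Range g = {}"
  shows "f \<union> g \<in> sym_inv_monoid X"
proof -
  have Un: "single_valued (r \<union> s)"
    if "single_valued r" "single_valued s" "Domain r \<inter> Domain s = {}" for r s :: "'a rel"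
  proof (rule single_valuedI)
    fix x y z assume "(x, y) \<in> r \<union> s" "(x, z) \<in> r \<union> s"
    hence "(x, y) \<in> r \<and> (x, z) \<in> r \<or> (x, y) \<in> s \<and> (x, z) \<in> s" using that(3) by blast
    thus "y = z" using that(1,2) by (auto dest: single_valuedD)
  qed
  have "single_valued (f \<union> g)"
    by (rule Un[OF inv_monoidD(4)[OF assms(1)] inv_monoidD(4)[OF assms(2)] assms(3)])
  moreover have "single_valued (f\<inverse> \<union> g\<inverse>)"
    by (rule Un[OF inv_monoidD(5)[OF assms(1)] inv_monoidD(5)[OF assms(2)]]) (simp add: assms(4))
  ultimately show ?thesis using assms by (simp add: sym_inv_monoid_def converse_Un)
qed

section \<open>The two classes without cardinals\<close>

lemma czero_ordLess_card_of: "(czero :: 'a rel) <o |A :: 'a set| \<longleftrightarrow> A \<noteq> {}"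
  unfolding czero_def
  by (metis card_of_Well_order card_of_empty3 not_ordLeq_iff_ordLess
      not_ordLess_ordLeq ordLeq_reflexive)

text \<open>The first set in the union covers the charts for which both equations fail, and
  \<open>Sym X\<close> those for which both hold.\<close>

lemma mem_semigroup_S_iff:
  "f \<in> semigroup_S X \<longleftrightarrow> f \<in> sym_inv_monoid X \<and> (Domain f = X \<longleftrightarrow> Range f = X)"
  unfolding semigroup_S_def Sym_def collapse_def defect_def czero_ordLess_card_of
  using inv_monoidD(2,3)[of f X] by auto

lemma card_of_ordIso_natLeq_iff:
  fixes A :: "'a set"
  assumes "countable A"
  shows "|A| =o natLeq \<longleftrightarrow> infinite A"
proof -
  obtain f :: "'a \<Rightarrow> nat" where "inj_on f A" using assms by (rule countableE)
  hence "|A| \<le>o |UNIV :: nat set|" by (rule card_of_ordLeqI) simp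
  hence "|A| \<le>o natLeq" using card_of_nat by (rule ordLeq_ordIso_trans)
  thus ?thesis using infinite_iff_natLeq_ordLeq[of A] by (simp add: ordIso_iff_ordLeq)
qed

text \<open>Complements in a countable set are either finite or of size aleph-zero, so the two
  alternatives merge into one equivalence.\<close>

lemma mem_semigroup_T_iff:
  assumes "countable X"
  shows "f \<in> semigroup_T X \<longleftrightarrow>
    f \<in> sym_inv_monoid X \<and> (finite (X - Domain f) \<longleftrightarrow> finite (X - Range f))"
  unfolding semigroup_T_def collapse_def defect_def
  using assms by (auto simp: card_of_ordIso_natLeq_iff finite_iff_ordLess_natLeq[symmetric])

section \<open>Closure of both classes under composition\<close>

text \<open>If \<open>f O g\<close> is total then so is \<open>f\<close>, hence \<open>f\<close> is
  onto, and therefore every point of \<open>X\<close> must be accepted by \<open>g\<close>. Applied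
  to \<open>g\<inverse>\<close> and \<open>f\<inverse>\<close>, this also gives the reverse
  implication.\<close>

lemma range_relcomp_total:
  assumes "single_valued f" "Domain f = X \<Longrightarrow> Range f = X" "Domain g = X \<Longrightarrow> Range g = X"
    and "f \<subseteq> X \<times> X" "g \<subseteq> X \<times> X" "Domain (f O g) = X"
  shows "Range (f O g) = X"
proof -
  have "Domain f = X" using assms(4,6) by blast
  hence f: "Range f = X" by (rule assms(2))
  have "X \<subseteq> Domain g"
  proof
    fix y assume "y \<in> X"
    then obtain x where "(x, y) \<in> f" using f by blast
    moreover then obtain y' z where "(x, y') \<in> f" "(y', z) \<in> g" using assms(4,6) by blast
    ultimately show "y \<in> Domain g" using assms(1) by (auto dest: single_valuedD)
  qed
  hence "Domain g = X" using assms(5) by blast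
  with assms(3) f have "Range g = X" by blast
  thus ?thesis using f assms(5) by blast
qed

lemma Image_single_valued:
  assumes "single_valued f" "finite A"
  shows finite_Image_single_valued: "finite (f `` A)"
    and card_Image_single_valued: "card (f `` A) \<le> card A"
proof -
  have "f `` A \<subseteq> (\<lambda>x. THE y. (x, y) \<in> f) ` A"
  proof
    fix y assume "y \<in> f `` A"
    then obtain x where x: "x \<in> A" "(x, y) \<in> f" by blast
    hence "(THE y. (x, y) \<in> f) = y" using assms(1) by (auto simp: single_valued_def)
    thus "y \<in> (\<lambda>x. THE y. (x, y) \<in> f) ` A" using x(1) by blast
  qed
  thus "finite (f `` A)" "card (f `` A) \<le> card A"
    using assms(2) finite_surj surj_card_le by blast+
qed

text \<open>The same argument up to finite sets: a point outside \<open>Domain g\<close> is either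
  missed by \<open>f\<close> or the image of a point outside \<open>Domain (f O g)\<close>.\<close>

lemma cofinite_range_relcomp:
  assumes "single_valued f" "single_valued g"
    and "finite (X - Domain f) \<Longrightarrow> finite (X - Range f)"
    and "finite (X - Domain g) \<Longrightarrow> finite (X - Range g)"
    and "f \<subseteq> X \<times> X" "g \<subseteq> X \<times> X" "finite (X - Domain (f O g))"
  shows "finite (X - Range (f O g))"
proof -
  have "finite (X - Domain f)" by (rule finite_subset[OF _ assms(7)]) auto
  hence f: "finite (X - Range f)" by (rule assms(3))
  have "X - Domain g \<subseteq> (X - Range f) \<union> f `` (X - Domain (f O g))"
  proof
    fix y assume y: "y \<in> X - Domain g"
    show "y \<in> (X - Range f) \<union> f `` (X - Domain (f O g))"
    proof (cases "y \<in> Range f")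
      case True
      then obtain x where x: "(x, y) \<in> f" by blast
      hence "x \<in> X - Domain (f O g)" using y assms(1,5) by (auto dest: single_valuedD)
      thus ?thesis using x by blast
    qed (use y in blast)
  qed
  hence "finite (X - Domain g)"
    using f finite_Image_single_valued[OF assms(1,7)] by (meson finite_UnI finite_subset)
  hence "finite (X - Range g)" by (rule assms(4))
  moreover have "X - Range (f O g) \<subseteq> (X - Range g) \<union> g `` (X - Range f)"
    using assms(6) by blast
  ultimately show ?thesis
    using finite_Image_single_valued[OF assms(2) f] by (meson finite_UnI finite_subset)
qed

lemma inverse_subsemigroup_S: "inverse_subsemigroup X (semigroup_S X)"
  unfolding inverse_subsemigroup_def
proof (intro conjI ballI)
  fix f g assume fg: "f \<in> semigroup_S X" "g \<in> semigroup_S X"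
  hence m: "f \<in> sym_inv_monoid X" "g \<in> sym_inv_monoid X"
    and e: "Domain f = X \<longleftrightarrow> Range f = X" "Domain g = X \<longleftrightarrow> Range g = X"
    by (auto simp: mem_semigroup_S_iff)
  note m' = m[THEN inv_monoid_converse]
  have "Domain (f O g) = X \<Longrightarrow> Range (f O g) = X"
    using range_relcomp_total[of f X g] m[THEN inv_monoidD(1)] m[THEN inv_monoidD(4)] e by blast
  moreover have "Range (f O g) = X \<Longrightarrow> Domain (f O g) = X"
    using range_relcomp_total[of "g\<inverse>" X "f\<inverse>"] m'[THEN inv_monoidD(1)] m'[THEN inv_monoidD(4)] e
    by (simp flip: converse_relcomp)
  ultimately show "f O g \<in> semigroup_S X"
    unfolding mem_semigroup_S_iff using inv_monoid_relcomp[OF m] by blast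
qed (auto simp: mem_semigroup_S_iff intro: inv_monoid_converse)

lemma inverse_subsemigroup_T:
  assumes "countable X"
  shows "inverse_subsemigroup X (semigroup_T X)"
  unfolding inverse_subsemigroup_def
proof (intro conjI ballI)
  note T = mem_semigroup_T_iff[OF assms]
  fix f g assume fg: "f \<in> semigroup_T X" "g \<in> semigroup_T X"
  hence m: "f \<in> sym_inv_monoid X" "g \<in> sym_inv_monoid X"
    and e: "finite (X - Domain f) \<longleftrightarrow> finite (X - Range f)"
      "finite (X - Domain g) \<longleftrightarrow> finite (X - Range g)"
    by (auto simp: T)
  note m' = m[THEN inv_monoid_converse]
  have "finite (X - Domain (f O g)) \<Longrightarrow> finite (X - Range (f O g))"
    using cofinite_range_relcomp[of f g X] m[THEN inv_monoidD(1)] m[THEN inv_monoidD(4)] e by blast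
  moreover have "finite (X - Range (f O g)) \<Longrightarrow> finite (X - Domain (f O g))"
    using cofinite_range_relcomp[of "g\<inverse>" "f\<inverse>" X] m'[THEN inv_monoidD(1)]
      m'[THEN inv_monoidD(4)] e
    by (simp flip: converse_relcomp)
  ultimately show "f O g \<in> semigroup_T X"
    unfolding T using inv_monoid_relcomp[OF m] by blast
qed (auto simp: mem_semigroup_T_iff[OF assms] intro: inv_monoid_converse)

lemma graph_mem_inv_monoid:
  assumes "inj_on \<phi> A" "A \<subseteq> X" "\<phi> ` A \<subseteq> X"
  shows "(\<lambda>x. (x, \<phi> x)) ` A \<in> sym_inv_monoid X"
  using assms by (auto simp: sym_inv_monoid_def single_valued_def inj_on_def)

lemma Domain_graph: "Domain ((\<lambda>x. (x, \<phi> x)) ` A) = A"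
  by force

lemma Range_graph: "Range ((\<lambda>x. (x, \<phi> x)) ` A) = \<phi> ` A"
  by force

lemma graph_mem_Sym: "bij_betw \<phi> X X \<Longrightarrow> (\<lambda>x. (x, \<phi> x)) ` X \<in> Sym X"
  by (simp add: Sym_def Domain_graph Range_graph graph_mem_inv_monoid bij_betw_def)

section \<open>Inverse subsemigroups containing all permutations\<close>

context
  fixes X :: "'a set" and M :: "'a rel set"
  assumes M: "inverse_subsemigroup X M" and Sym: "Sym X \<subseteq> M"
begin

lemma subsemigroup_closed:
  "f \<in> M \<Longrightarrow> f \<in> sym_inv_monoid X"
  "f \<in> M \<Longrightarrow> g \<in> M \<Longrightarrow> f O g \<in> M"
  "f \<in> M \<Longrightarrow> f\<inverse> \<in> M"
  using M by (auto simp: inverse_subsemigroup_def)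

text \<open>Induction on the collapse of \<open>g\<close>, which drops with each replacement of
  \<open>g\<close> by \<open>f O p O g\<close>. The defect stays infinite since the image only
  shrinks.\<close>

lemma exists_total_infinite_defect:
  assumes f: "f \<in> M" "Domain f = X" "Range f \<noteq> X"
    and "g \<in> M" "finite (X - Domain g)" "infinite (X - Range g)"
  shows "\<exists>u\<in>M. Domain u = X \<and> infinite (X - Range u)"
  using assms(4-6)
proof (induction "card (X - Domain g)" arbitrary: g rule: less_induct)
  case less
  note g = inv_monoidD[OF subsemigroup_closed(1)[OF less.prems(1)]]
  show ?case
  proof (cases "Domain g = X")
    case True
    then show ?thesis using less.prems by blast
  next
    case False
    note F = inv_monoidD[OF subsemigroup_closed(1)[OF f(1)]]
    obtain b where b: "b \<in> X" "b \<notin> Domain g" using False g by blast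
    obtain a where a: "a \<in> X" "a \<notin> Range f" using f F by blast
    \<comment> \<open>If \<open>a = b\<close>, this is the identity, which serves equally
      well.\<close>
    define \<phi> where "\<phi> x = (if x = a then b else if x = b then a else x)" for x
    have \<phi>: "bij_betw \<phi> X X" using a b
      by (intro bij_betw_byWitness[where f' = \<phi>]) (auto simp: \<phi>_def)
    define p where "p = (\<lambda>x. (x, \<phi> x)) ` X"
    have p: "p \<in> M" using graph_mem_Sym[OF \<phi>] Sym unfolding p_def by blast
    define h where "h = f O p O g"
    have h: "h \<in> M" unfolding h_def using f p less.prems(1) by (intro subsemigroup_closed)
    \<comment> \<open>Only \<open>a\<close> is sent to \<open>b\<close> by \<open>p\<close>, and
      \<open>f\<close> misses \<open>a\<close>; so the gap \<open>b\<close> of \<open>g\<close> has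
      no preimage and causes no gap in \<open>Domain h\<close>.\<close>
    have sub: "X - Domain h \<subseteq> (p\<inverse> O f\<inverse>) `` (X - Domain g - {b})"
    proof
      fix x assume x: "x \<in> X - Domain h"
      then obtain y where y: "(x, y) \<in> f" using f by blast
      hence "y \<in> X" "y \<noteq> a" using F a by auto
      hence "(y, \<phi> y) \<in> p" "\<phi> y \<in> X" "\<phi> y \<noteq> b"
        using \<phi> a b by (auto simp: p_def \<phi>_def bij_betw_def)
      moreover have "\<phi> y \<notin> Domain g"
        using x y \<open>(y, \<phi> y) \<in> p\<close> unfolding h_def by blast
      ultimately show "x \<in> (p\<inverse> O f\<inverse>) `` (X - Domain g - {b})" using y by blast
    qed
    have sv: "single_valued (p\<inverse> O f\<inverse>)"
      using inv_monoidD(5)[OF subsemigroup_closed(1)[OF p]] F(5) by (rule single_valued_relcomp)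
    have fin: "finite (X - Domain g - {b})" using less.prems(2) by simp
    have "card (X - Domain h) \<le> card ((p\<inverse> O f\<inverse>) `` (X - Domain g - {b}))"
      using sub finite_Image_single_valued[OF sv fin] by (intro card_mono)
    also have "\<dots> \<le> card (X - Domain g - {b})" using sv fin by (rule card_Image_single_valued)
    also have "\<dots> < card (X - Domain g)" using b less.prems(2) by (intro card_Diff1_less) auto
    finally have "card (X - Domain h) < card (X - Domain g)" .
    moreover have "finite (X - Domain h)"
      using sub finite_Image_single_valued[OF sv fin] by (rule finite_subset)
    moreover have "infinite (X - Range h)"
      using less.prems(3) by (rule contrapos_nn) (erule finite_subset[rotated], auto simp: h_def)
    ultimately show ?thesis using less.hyps[OF _ h] by blast
  qed
qed

text \<open>The chart \<open>u\<inverse> O v\<close> carries the image of \<open>u\<close> onto that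
  of \<open>v\<close>. A bijection between the complements, both countably infinite, extends it to a
  permutation, and \<open>u\<close> followed by this permutation is \<open>v\<close>.\<close>

lemma total_infinite_defect_mem:
  assumes "countable X" and u: "u \<in> M" "Domain u = X" "infinite (X - Range u)"
    and v: "v \<in> sym_inv_monoid X" "Domain v = X" "infinite (X - Range v)"
  shows "v \<in> M"
proof -
  note U = inv_monoidD[OF subsemigroup_closed(1)[OF u(1)]] and V = inv_monoidD[OF v(1)]
  obtain q where q: "bij_betw q (X - Range u) (X - Range v)"
    using assms(1) u(3) v(3) countableE_infinite[of "X - Range u"] countableE_infinite[of "X - Range v"]
    by (metis bij_betw_inv_into bij_betw_trans countable_Diff)
  define Q where "Q = (\<lambda>x. (x, q x)) ` (X - Range u)"
  have Q: "Domain Q = X - Range u" "Range Q = X - Range v" "Q \<in> sym_inv_monoid X"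
    using q graph_mem_inv_monoid[of q "X - Range u" X]
    by (auto simp: Q_def Domain_graph Range_graph bij_betw_def)
  define P where "P = u\<inverse> O v"
  have P: "Domain P = Range u" "Range P = Range v" "P \<in> sym_inv_monoid X"
  proof -
    show "Domain P = Range u" "Range P = Range v" unfolding P_def using u(2) v(2) U V by blast+
    show "P \<in> sym_inv_monoid X" unfolding P_def
      using subsemigroup_closed(1)[OF u(1)] v(1) by (intro inv_monoid_relcomp inv_monoid_converse)
  qed
  have "P \<union> Q \<in> sym_inv_monoid X"
    using P(3) Q(3) by (rule inv_monoid_Un) (use P(1,2) Q(1,2) in auto)
  hence "P \<union> Q \<in> Sym X"
    using P Q U V by (auto simp: Sym_def Domain_Un_eq Range_Un_eq)
  hence "u O (P \<union> Q) \<in> M" using Sym u(1) by (intro subsemigroup_closed) auto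
  also have "u O (P \<union> Q) = v"
  proof -
    have "u O Q = {}" using Q by blast
    moreover have "u O u\<inverse> = Id_on X" using u(2) U by (auto simp: single_valued_def Id_on_iff)
    moreover have "Id_on X O v = v" using V(1) by blast
    ultimately show ?thesis by (simp add: P_def O_assoc[symmetric])
  qed
  finally show ?thesis .
qed

text \<open>A chart \<open>h\<close> is factored as the graph of \<open>r 0\<close> followed by the
  converse of the graph of \<open>w\<close>. Both maps are injective on \<open>X\<close> with
  infinite defect, so the preceding lemma puts their graphs in \<open>M\<close>.\<close>

lemma eq_inv_monoid_if_total_infinite_defect:
  assumes X: "countable X" "infinite X"
    and u: "u \<in> M" "Domain u = X" "infinite (X - Range u)"
  shows "M = sym_inv_monoid X"
proof (intro equalityI subsetI)
  fix h assume h: "h \<in> sym_inv_monoid X"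
  note H = inv_monoidD[OF h]
  obtain e where e: "bij_betw e X (UNIV :: nat set)" using X by (rule countableE_infinite)
  \<comment> \<open>Three disjoint copies of \<open>X\<close> inside \<open>X\<close>: two to be amalgamated along \<open>h\<close>, the last one to keep
    the defects infinite.\<close>
  define r where "r i x = from_nat_into X (3 * e x + i)" for i x
  have fX: "inj (from_nat_into X)" "range (from_nat_into X) = X"
    using bij_betw_from_nat_into[OF X] by (auto simp: bij_betw_def)
  have rX: "r i x \<in> X" for i x unfolding r_def using fX(2) by auto
  have r_eq: "r i x = r j y \<longleftrightarrow> i = j \<and> x = y" if "i < 3" "j < 3" "x \<in> X" "y \<in> X" for i j x y
  proof -
    have "r i x = r j y \<longleftrightarrow> 3 * e x + i = 3 * e y + j" using fX(1) by (simp add: r_def inj_eq)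
    also have "\<dots> \<longleftrightarrow> i = j \<and> e x = e y" using that(1,2) by presburger
    also have "e x = e y \<longleftrightarrow> x = y" using e that(3,4) by (auto simp: bij_betw_def inj_on_eq_iff)
    finally show ?thesis .
  qed
  \<comment> \<open>Avoiding the third copy of \<open>X\<close> is enough for an infinite
    complement.\<close>
  have inf: "infinite (X - B)" if "B \<inter> r 2 ` X = {}" for B
  proof
    assume "finite (X - B)"
    moreover have "r 2 ` X \<subseteq> X - B" using that rX by auto
    ultimately have "finite (r 2 ` X)" by (rule rev_finite_subset)
    moreover have "inj_on (r 2) X" using r_eq by (auto intro: inj_onI)
    ultimately show False using X(2) finite_imageD by blast
  qed
  \<comment> \<open>\<open>w\<close> embeds the second copy, except that each \<open>y\<close> in
    the image of \<open>h\<close> is glued to its preimage in the first copy. Injectivity of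
    \<open>h\<close> makes \<open>w\<close> well defined, single-valuedness of \<open>h\<close>
    makes \<open>w\<close> injective.\<close>
  define w where "w y = (if y \<in> Range h then r 0 (THE x. (x, y) \<in> h) else r 1 y)" for y
  have w1: "w y = r 0 x" if "(x, y) \<in> h" for x y
  proof -
    have "(THE x. (x, y) \<in> h) = x" using that H(5) by (auto simp: single_valued_def)
    thus ?thesis using that by (auto simp: w_def)
  qed
  have w2: "w y = r 1 y" if "y \<notin> Range h" for y using that by (simp add: w_def)
  have w_eq: "r 0 x = w y \<longleftrightarrow> (x, y) \<in> h" if "x \<in> X" "y \<in> X" for x y
  proof (cases "y \<in> Range h")
    case True
    then obtain x' where "(x', y) \<in> h" by blast
    thus ?thesis using w1[of x' y] r_eq[of 0 0 x x'] that H by (auto dest: single_valuedD)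
  next
    case False
    thus ?thesis using w2[of y] r_eq[of 0 1 x y] that by auto
  qed
  have w_inj: "inj_on w X"
  proof (rule inj_onI)
    fix y y' assume y: "y \<in> X" "y' \<in> X" "w y = w y'"
    show "y = y'"
    proof (cases "y \<in> Range h")
      case True
      then obtain x where x: "(x, y) \<in> h" by blast
      hence "(x, y') \<in> h" using w1[OF x] w_eq[of x y'] y H by auto
      thus ?thesis using x H(4) by (auto dest: single_valuedD)
    next
      case False
      have "y' \<notin> Range h"
      proof
        assume "y' \<in> Range h"
        then obtain x where x: "(x, y') \<in> h" by blast
        hence "(x, y) \<in> h" using w1[OF x] w_eq[of x y] y H by auto
        thus False using False by blast
      qed
      thus ?thesis using False y w2 r_eq[of 1 1 y y'] by simp
    qed
  qed
  have wX: "w ` X \<subseteq> X" using rX by (auto simp: w_def)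
  have "r 0 ` X \<inter> r 2 ` X = {}" using r_eq[of 0 2] by auto
  moreover have "w ` X \<inter> r 2 ` X = {}"
  proof -
    have "w y \<noteq> r 2 x" if xy: "x \<in> X" "y \<in> X" for x y
    proof (cases "y \<in> Range h")
      case True
      then obtain x' where "(x', y) \<in> h" by blast
      thus ?thesis using w1[of x' y] r_eq[of 0 2 x' x] xy H by auto
    next
      case False
      thus ?thesis using w2[of y] r_eq[of 1 2 y x] xy by auto
    qed
    thus ?thesis by blast
  qed
  ultimately have inf': "infinite (X - r 0 ` X)" "infinite (X - w ` X)" using inf by blast+
  have mem: "(\<lambda>x. (x, \<phi> x)) ` X \<in> M"
    if "inj_on \<phi> X" "\<phi> ` X \<subseteq> X" "infinite (X - \<phi> ` X)" for \<phi>
    using total_infinite_defect_mem[OF X(1) u] graph_mem_inv_monoid[OF that(1) _ that(2)] that(3)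
    by (simp add: Domain_graph Range_graph)
  have "inj_on (r 0) X" using r_eq by (auto intro: inj_onI)
  moreover have "r 0 ` X \<subseteq> X" using rX by auto
  ultimately have "(\<lambda>x. (x, r 0 x)) ` X O ((\<lambda>x. (x, w x)) ` X)\<inverse> \<in> M"
    using mem inf' w_inj wX by (intro subsemigroup_closed) blast+
  also have "(\<lambda>x. (x, r 0 x)) ` X O ((\<lambda>x. (x, w x)) ` X)\<inverse> = {(x, y). x \<in> X \<and> y \<in> X \<and> r 0 x = w y}"
    by auto
  also have "\<dots> = h" using w_eq H by auto
  finally show "h \<in> M" .
qed (rule subsemigroup_closed)

lemma eq_inv_monoid_if_not_subset:
  assumes X: "countable X" "infinite X"
    and "\<not> M \<subseteq> semigroup_S X" "\<not> M \<subseteq> semigroup_T X"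
  shows "M = sym_inv_monoid X"
proof -
  obtain f where "f \<in> M" "Domain f = X \<longleftrightarrow> Range f \<noteq> X"
    using assms(3) subsemigroup_closed(1) unfolding subset_iff mem_semigroup_S_iff by blast
  \<comment> \<open>Exactly one of totality and surjectivity holds, so either the chart or its
    converse is total and not onto.\<close>
  then obtain f where f: "f \<in> M" "Domain f = X" "Range f \<noteq> X"
    using subsemigroup_closed(3)[of f] by (metis Domain_converse Range_converse)
  obtain g where "g \<in> M" "finite (X - Domain g) \<longleftrightarrow> infinite (X - Range g)"
    using assms(4) subsemigroup_closed(1) unfolding subset_iff mem_semigroup_T_iff[OF X(1)] by blast
  then obtain g where g: "g \<in> M" "finite (X - Domain g)" "infinite (X - Range g)"
    using subsemigroup_closed(3)[of g] by (metis Domain_converse Range_converse)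
  obtain u where "u \<in> M" "Domain u = X" "infinite (X - Range u)"
    using exists_total_infinite_defect[OF f g] by blast
  thus ?thesis by (rule eq_inv_monoid_if_total_infinite_defect[OF X])
qed

end

section \<open>Incomparability of the two classes\<close>

lemma exists_chart:
  assumes X: "countable X" "infinite X" and \<phi>: "inj_on \<phi> (A :: nat set)"
  obtains f where "f \<in> sym_inv_monoid X" "X - Domain f = from_nat_into X ` (- A)"
    "X - Range f = from_nat_into X ` (- \<phi> ` A)"
proof -
  define e where "e = from_nat_into X"
  have e: "inj e" "range e = X"
    using bij_betw_from_nat_into[OF X] by (auto simp: bij_betw_def e_def)
  define f where "f = (\<lambda>n. (e n, e (\<phi> n))) ` A"
  have "Domain f = e ` A" "Range f = e ` \<phi> ` A" by (force simp: f_def)+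
  moreover have "f \<in> sym_inv_monoid X"
    using e \<phi> by (auto simp: f_def sym_inv_monoid_def single_valued_def inj_def inj_on_def)
  ultimately show ?thesis
    using that[of f] e by (simp add: e_def[symmetric] Compl_eq_Diff_UNIV image_set_diff)
qed

text \<open>The successor map, transported to \<open>X\<close>, has collapse 0 and defect 1.\<close>

lemma semigroup_T_not_subset_S:
  assumes X: "countable X" "infinite X"
  shows "\<not> semigroup_T X \<subseteq> semigroup_S X"
proof -
  obtain f where f: "f \<in> sym_inv_monoid X" "X - Domain f = from_nat_into X ` (- UNIV)"
    "X - Range f = from_nat_into X ` (- range Suc)"
    using exists_chart[OF X, of Suc UNIV] by auto
  have "- range Suc = {0}" by (auto simp: image_iff) (metis not0_implies_Suc)
  hence "X - Domain f = {}" "X - Range f \<noteq> {}" "finite (X - Domain f)" "finite (X - Range f)"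
    unfolding f(2,3) by simp_all
  hence "f \<in> semigroup_T X" "f \<notin> semigroup_S X"
    unfolding mem_semigroup_T_iff[OF X(1)] mem_semigroup_S_iff
    using f(1) inv_monoidD(2)[OF f(1)] by blast+
  thus ?thesis by blast
qed

text \<open>The witness is doubling on the nonzero naturals: collapse 1, and infinite defect because
  of the odd numbers. Dropping 0 from the domain is what keeps it in \<open>semigroup_S X\<close>,
  where a total chart has to be onto.\<close>

lemma semigroup_S_not_subset_T:
  assumes X: "countable X" "infinite X"
  shows "\<not> semigroup_S X \<subseteq> semigroup_T X"
proof -
  obtain f where f: "f \<in> sym_inv_monoid X" "X - Domain f = from_nat_into X ` (- (- {0}))"
    "X - Range f = from_nat_into X ` (- (\<lambda>n. 2 * n) ` (- {0}))"
    using exists_chart[OF X, of "\<lambda>n. 2 * n" "- {0}"] by (auto simp: inj_on_def)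
  have "range (\<lambda>n. 2 * n + 1 :: nat) \<subseteq> - (\<lambda>n. 2 * n) ` (- {0})" by auto presburger
  moreover have "infinite (range (\<lambda>n. 2 * n + 1 :: nat))"
    by (intro range_inj_infinite injI) simp
  ultimately have "infinite (- (\<lambda>n. 2 * n :: nat) ` (- {0}))" using finite_subset by blast
  hence "infinite (X - Range f)"
    unfolding f(3) using bij_betw_from_nat_into[OF X]
    by (metis bij_betw_imp_inj_on finite_imageD inj_on_subset subset_UNIV)
  moreover have "X - Domain f \<noteq> {}" "finite (X - Domain f)" using f by auto
  moreover from \<open>infinite (X - Range f)\<close> have "X - Range f \<noteq> {}" by fastforce
  ultimately have "f \<in> semigroup_S X" "f \<notin> semigroup_T X"
    unfolding mem_semigroup_T_iff[OF X(1)] mem_semigroup_S_iff using f(1) by blast+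
  thus ?thesis by blast
qed

theorem corollary3p20:
  fixes X :: "'a set"
  assumes "countable X" and "infinite X"
  shows "{M. maximal_inverse_subsemigroup X M \<and> Sym X \<subseteq> M} = {semigroup_S X, semigroup_T X}
         \<and> semigroup_S X \<noteq> semigroup_T X"
proof -
  let ?S = "semigroup_S X" and ?T = "semigroup_T X" and ?I = "sym_inv_monoid X"
  have ST: "inverse_subsemigroup X ?S" "inverse_subsemigroup X ?T" "\<not> ?S \<subseteq> ?T" "\<not> ?T \<subseteq> ?S"
    using inverse_subsemigroup_S inverse_subsemigroup_T semigroup_S_not_subset_T
      semigroup_T_not_subset_S assms by blast+
  \<comment> \<open>A class equal to the whole monoid would contain the other one.\<close>
  hence proper: "?S \<noteq> ?I" "?T \<noteq> ?I" unfolding inverse_subsemigroup_def by blast+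
  have Sym: "Sym X \<subseteq> ?S" "Sym X \<subseteq> ?T"
    unfolding subset_iff mem_semigroup_S_iff mem_semigroup_T_iff[OF assms(1)] Sym_def by simp_all
  have dichotomy: "M \<subseteq> ?S \<or> M \<subseteq> ?T"
    if "inverse_subsemigroup X M" "Sym X \<subseteq> M" "M \<noteq> ?I" for M
    using eq_inv_monoid_if_not_subset[OF that(1,2) assms] that(3) by blast
  \<comment> \<open>A proper inverse subsemigroup above one class contains \<open>Sym X\<close>, so
    it lies in one of the two classes; incomparability rules out the other one.\<close>
  have "maximal_inverse_subsemigroup X ?S" "maximal_inverse_subsemigroup X ?T"
    unfolding maximal_inverse_subsemigroup_def using ST proper Sym dichotomy by blast+
  moreover have "M = ?S \<or> M = ?T" if "maximal_inverse_subsemigroup X M" "Sym X \<subseteq> M" for M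
    using that dichotomy[of M] ST proper unfolding maximal_inverse_subsemigroup_def by metis
  ultimately show ?thesis using Sym ST by blast
qed

end
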